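(* Let $k$ be a fixed non-negative integer and let $n$ be a non-negative integer. The number of partitions of $n$ into distinct parts with exactly $k$ odd-indexed odd parts is equal to the number of partitions of $n$ into distinct parts with exactly $k$ parts congruent to $1$ modulo $4$. Likewise, the number of partitions of $n$ into distinct parts with exactly $k$ even-indexed odd parts is equal to the number of partitions of $n$ into distinct parts with exactly $k$ parts congruent to $3$ modulo $4$.
   Context: A partition $\pi=(\lambda_1,\lambda_2,\dots)$ is a finite non-increasing sequence of positive integers (its parts); it is a partition of $n$ if the parts sum to $n$. The empty sequence is the unique partition of $0$. The parts $\lambda_{2r-1}$ ($r\ge 1$) are called odd-indexed and the parts $\lambda_{2r}$ ($r\geq 1$) even-indexed. An odd-indexed (even-indexed) odd part is an odd-indexed (even-indexed) part whose value is odd. *)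

theory Defs
  imports "HOL-Number_Theory.Cong"
begin

definition is_partition :: "nat list \<Rightarrow> bool" where
  "is_partition xs \<longleftrightarrow> sorted_wrt (\<ge>) xs \<and> (\<forall>x \<in> set xs. 0 < x)"

definition partitions_of :: "nat \<Rightarrow> nat list set" where
  "partitions_of n = {xs. is_partition xs \<and> sum_list xs = n}"

definition distinct_partitions_of :: "nat \<Rightarrow> nat list set" where
  "distinct_partitions_of n = {xs \<in> partitions_of n. distinct xs}"

text \<open>Parts are numbered from 1, so the part with index \<open>j\<close> is \<open>xs ! (j - 1)\<close>.\<close>

definition num_odd_indexed_odd_parts :: "nat list \<Rightarrow> nat" where
  "num_odd_indexed_odd_parts xs = card {j \<in> {1..length xs}. odd j \<and> odd (xs ! (j - 1))}"

definition num_even_indexed_odd_parts :: "nat list \<Rightarrow> nat" where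
  "num_even_indexed_odd_parts xs = card {j \<in> {1..length xs}. even j \<and> odd (xs ! (j - 1))}"

definition num_parts_cong :: "nat \<Rightarrow> nat \<Rightarrow> nat list \<Rightarrow> nat" where
  "num_parts_cong a m xs = length (filter (\<lambda>x. [x = a] (mod m)) xs)"

text \<open>Finiteness, so that \<^const>\<open>card\<close> really counts sets of partitions of \<open>n\<close>.\<close>

lemma finite_partitions_of: "finite (partitions_of n)"
proof (rule finite_subset)
  have len: "length xs \<le> sum_list xs" if "\<forall>x \<in> set xs. 0 < x" for xs :: "nat list"
    using that by (induction xs) auto
  show "partitions_of n \<subseteq> {xs. set xs \<subseteq> {..n} \<and> length xs \<le> n}"
    using len by (auto simp: partitions_of_def is_partition_def intro: member_le_sum_list)
  show "finite {xs. set xs \<subseteq> {..n} \<and> length xs \<le> n}"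
    by (rule finite_lists_length_le) simp
qed

lemma finite_distinct_partitions_of: "finite (distinct_partitions_of n)"
  unfolding distinct_partitions_of_def
  by (rule finite_subset[OF _ finite_partitions_of[of n]]) auto

end

theory Submission
  imports Defs "HOL-Computational_Algebra.Polynomial" "HOL-Library.Multiset"
begin

text \<open>
  Let \<open>A\<^sub>N(x, y)\<close> be the generating function in \<open>q\<close> of the partitions into distinct parts that are at
  most \<open>N\<close>, where \<open>x\<close> marks odd-indexed and \<open>y\<close> even-indexed odd parts. Prepending a part exchanges
  the two kinds of index, which gives a linear recurrence for the pair \<open>A\<^sub>N(x, y)\<close>, \<open>A\<^sub>N(y, x)\<close>. Two
  steps of it show by induction that
  \<open>A\<^bsub>2N+1\<^esub>(x, y) = (1 + x q) A\<^bsub>2N\<^esub>(y q\<^sup>2, x q\<^sup>2)\<close>.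
  The product \<open>\<Prod>\<^bsub>i \<le> N\<^esub> (1 + w\<^sub>i q\<^sup>i)\<close>, where \<open>x\<close> marks parts congruent to 1 and \<open>y\<close> parts
  congruent to 3 modulo 4, satisfies the same identity. Comparing coefficients, this identity determines
  the joint distribution of the two statistics, except on the partitions without odd parts, where both
  statistics vanish.
\<close>

section \<open>Partitions into distinct parts of bounded size\<close>

definition strict_partitions_upto :: "nat \<Rightarrow> nat list set" where
  "strict_partitions_upto N = {xs. sorted_wrt (>) xs \<and> set xs \<subseteq> {1..N}}"

lemma sorted_wrt_greater_iff:
  fixes xs :: "'a::linorder list"
  shows "sorted_wrt (>) xs \<longleftrightarrow> sorted_wrt (\<ge>) xs \<and> distinct xs"
  by (induction xs) (auto simp: order_less_le)

lemma strict_partitions_upto_0: "strict_partitions_upto 0 = {[]}"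
  by (auto simp: strict_partitions_upto_def)

lemma strict_partitions_upto_Suc:
  "strict_partitions_upto (Suc N) =
     strict_partitions_upto N \<union> Cons (Suc N) ` strict_partitions_upto N"
proof (intro equalityI subsetI)
  fix xs assume xs: "xs \<in> strict_partitions_upto (Suc N)"
  show "xs \<in> strict_partitions_upto N \<union> Cons (Suc N) ` strict_partitions_upto N"
  proof (cases xs)
    case Nil
    then show ?thesis by (simp add: strict_partitions_upto_def)
  next
    case (Cons y ys)
    have "ys \<in> strict_partitions_upto N"
      using xs Cons by (fastforce simp: strict_partitions_upto_def)
    moreover have "xs \<in> strict_partitions_upto N" if "y \<noteq> Suc N"
      using xs Cons that by (fastforce simp: strict_partitions_upto_def)
    ultimately show ?thesis using Cons by blast
  qed
next
  fix xs assume "xs \<in> strict_partitions_upto N \<union> Cons (Suc N) ` strict_partitions_upto N"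
  then show "xs \<in> strict_partitions_upto (Suc N)"
    by (fastforce simp: strict_partitions_upto_def)
qed

lemma finite_strict_partitions_upto [simp]: "finite (strict_partitions_upto N)"
  by (induction N) (auto simp: strict_partitions_upto_0 strict_partitions_upto_Suc)

text \<open>No part of a partition of \<open>n\<close> exceeds \<open>n\<close>, so every bound from
  \<open>n\<close> on gives the same set; this slack lets a single bound serve several sizes at
  once.\<close>

lemma distinct_partitions_of_eq:
  assumes "n \<le> N"
  shows "distinct_partitions_of n = {xs \<in> strict_partitions_upto N. sum_list xs = n}"
proof -
  have "set xs \<subseteq> {1..N} \<longleftrightarrow> (\<forall>x \<in> set xs. 0 < x)" if "sum_list xs = n" for xs
    using that assms member_le_sum_list[of _ xs] by (fastforce simp: Suc_le_eq)
  then show ?thesis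
    by (auto simp: distinct_partitions_of_def partitions_of_def is_partition_def
        strict_partitions_upto_def sorted_wrt_greater_iff)
qed

text \<open>The marks are arbitrary ring elements, so replacing \<open>x\<close> by
  \<open>y * q ^ 2\<close> is merely another argument; indeterminates enter only when coefficients
  are compared.\<close>

definition strict_gf ::
    "(nat list \<Rightarrow> nat) \<Rightarrow> (nat list \<Rightarrow> nat) \<Rightarrow> nat \<Rightarrow> 'a \<Rightarrow> 'a \<Rightarrow> 'a \<Rightarrow> 'a::comm_ring_1" where
  "strict_gf f g N x y q = (\<Sum>xs\<in>strict_partitions_upto N. x ^ f xs * y ^ g xs * q ^ sum_list xs)"

lemma strict_gf_Suc:
  "strict_gf f g (Suc N) x y q = strict_gf f g N x y q +
     (\<Sum>xs\<in>strict_partitions_upto N.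
        x ^ f (Suc N # xs) * y ^ g (Suc N # xs) * q ^ (Suc N + sum_list xs))"
proof -
  have "strict_partitions_upto N \<inter> Cons (Suc N) ` strict_partitions_upto N = {}"
    by (auto simp: strict_partitions_upto_def)
  then show ?thesis
    by (simp add: strict_gf_def strict_partitions_upto_Suc sum.union_disjoint sum.reindex)
qed

section \<open>Recursions for the four statistics\<close>

text \<open>Removing the head lowers every other index by one. With \<open>P\<close> general, one
  proof covers \<open>odd\<close> and \<open>even\<close>; the parity of \<open>Suc j\<close> is
  what exchanges the two statistics.\<close>

lemma card_indices_Cons:
  "card {j \<in> {1..length (x # xs)}. P j \<and> odd ((x # xs) ! (j - 1))} =
     of_bool (P 1 \<and> odd x) + card {j \<in> {1..length xs}. P (Suc j) \<and> odd (xs ! (j - 1))}"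
proof -
  let ?A = "{j \<in> {1..length xs}. P (Suc j) \<and> odd (xs ! (j - 1))}"
  have "{j \<in> {1..length (x # xs)}. P j \<and> odd ((x # xs) ! (j - 1))} =
          (if P 1 \<and> odd x then {1} else {}) \<union> Suc ` ?A" (is "?L = ?R")
  proof (intro set_eqI)
    fix j
    show "j \<in> ?L \<longleftrightarrow> j \<in> ?R"
    proof (cases "j \<le> 1")
      case True
      then have "j = 0 \<or> j = 1" by auto
      then show ?thesis by auto
    next
      case False
      then obtain i where "j = Suc (Suc i)" by (metis One_nat_def not_less_eq_eq Suc_le_D)
      then show ?thesis by (auto simp: image_iff)
    qed
  qed
  moreover have "card ((if P 1 \<and> odd x then {1} else {}) \<union> Suc ` ?A) =
      card (if P 1 \<and> odd x then {1::nat} else {}) + card (Suc ` ?A)"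
    by (rule card_Un_disjoint) auto
  ultimately show ?thesis
    by (simp add: card_image)
qed

lemma num_odd_indexed_odd_parts_simps [simp]:
  "num_odd_indexed_odd_parts [] = 0"
  "num_odd_indexed_odd_parts (x # xs) = of_bool (odd x) + num_even_indexed_odd_parts xs"
  using card_indices_Cons[of x xs odd]
  by (simp_all add: num_odd_indexed_odd_parts_def num_even_indexed_odd_parts_def)

lemma num_even_indexed_odd_parts_simps [simp]:
  "num_even_indexed_odd_parts [] = 0"
  "num_even_indexed_odd_parts (x # xs) = num_odd_indexed_odd_parts xs"
  using card_indices_Cons[of x xs even]
  by (simp_all add: num_odd_indexed_odd_parts_def num_even_indexed_odd_parts_def)

lemma num_parts_cong_simps [simp]:
  "num_parts_cong a m [] = 0"
  "num_parts_cong a m (x # xs) = of_bool ([x = a] (mod m)) + num_parts_cong a m xs"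
  by (simp_all add: num_parts_cong_def)

text \<open>With \<open>num_parts_cong_sum\<close>, this gives both pairs of statistics the same
  total, which settles the one case that the coefficient recursion misses.\<close>

lemma num_indexed_odd_parts_sum:
  "num_odd_indexed_odd_parts xs + num_even_indexed_odd_parts xs = length (filter odd xs)"
  by (induction xs) auto

lemma num_parts_cong_sum:
  "num_parts_cong 1 4 xs + num_parts_cong 3 4 xs = length (filter odd xs)"
proof (induction xs)
  case (Cons x xs)
  have "odd x \<longleftrightarrow> x mod 4 = 1 \<or> x mod 4 = 3"
    by presburger
  then show ?case using Cons by (auto simp: cong_def)
qed simp

section \<open>Functional equations of the two generating functions\<close>

abbreviation (input) index_gf where
  "index_gf \<equiv> strict_gf num_odd_indexed_odd_parts num_even_indexed_odd_parts"

abbreviation (input) mod4_gf where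
  "mod4_gf \<equiv> strict_gf (num_parts_cong 1 4) (num_parts_cong 3 4)"

text \<open>A new largest part takes index 1 and moves all others to an index of opposite parity,
  hence \<open>x\<close> and \<open>y\<close> trade places in the second term.\<close>

lemma index_gf_Suc:
  "index_gf (Suc N) x y q =
     index_gf N x y q + (if odd (Suc N) then x else 1) * q ^ Suc N * index_gf N y x q"
  unfolding strict_gf_Suc
  by (simp add: strict_gf_def sum_distrib_left power_add mult_ac)

lemma mod4_gf_Suc:
  "mod4_gf (Suc N) x y q =
     (1 + (if [Suc N = 1] (mod 4) then x else if [Suc N = 3] (mod 4) then y else 1) * q ^ Suc N)
       * mod4_gf N x y q"
proof -
  have "\<not> ([Suc N = 1] (mod 4) \<and> [Suc N = 3] (mod 4))"
    by (auto simp: cong_def)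
  then show ?thesis
    unfolding strict_gf_Suc
    by (auto simp: strict_gf_def sum_distrib_left power_add algebra_simps)
qed

lemma index_gf_shift:
  "index_gf (2 * N + 1) x y q = (1 + x * q) * index_gf (2 * N) (y * q ^ 2) (x * q ^ 2) q"
proof (induction N arbitrary: x y)
  case 0
  show ?case by (simp add: strict_gf_def strict_partitions_upto_0 strict_partitions_upto_Suc)
next
  case (Suc N)
  \<comment> \<open>With \<open>t\<close> for the varying power, all other exponents of
    \<open>q\<close> are numerals.\<close>
  define t where "t = q ^ (2 * N)"
  have top: "index_gf (2 * Suc N + 1) x y q =
      (1 + x * t * t * q ^ 5) * index_gf (2 * N + 1) x y q
        + t * q ^ 2 * (1 + x * q) * index_gf (2 * N + 1) y x q"
  proof -
    have step1: "index_gf (2 * Suc N + 1) x y q =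
        index_gf (2 * N + 2) x y q + x * (t * q ^ 3) * index_gf (2 * N + 2) y x q"
      using index_gf_Suc[of "2 * N + 2" x y q]
      by (simp add: t_def power2_eq_square power3_eq_cube mult_ac)
    have step2: "index_gf (2 * N + 2) u v q =
        index_gf (2 * N + 1) u v q + t * q ^ 2 * index_gf (2 * N + 1) v u q" for u v
      using index_gf_Suc[of "2 * N + 1" u v q]
      by (simp add: t_def power2_eq_square power3_eq_cube mult_ac)
    show ?thesis
      unfolding step1 step2 by (simp add: algebra_simps eval_nat_numeral)
  qed
  have bottom: "index_gf (2 * Suc N) u v q =
      (1 + v * t * t * q ^ 3) * index_gf (2 * N) u v q
        + t * q * (u + q) * index_gf (2 * N) v u q" for u v
  proof -
    have step1: "index_gf (2 * Suc N) u v q =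
        index_gf (2 * N + 1) u v q + t * q ^ 2 * index_gf (2 * N + 1) v u q"
      using index_gf_Suc[of "2 * N + 1" u v q]
      by (simp add: t_def power2_eq_square power3_eq_cube mult_ac)
    have step2: "index_gf (2 * N + 1) u v q =
        index_gf (2 * N) u v q + u * (t * q) * index_gf (2 * N) v u q" for u v
      using index_gf_Suc[of "2 * N" u v q] by (simp add: t_def mult_ac)
    show ?thesis
      unfolding step1 step2 by (simp add: algebra_simps eval_nat_numeral)
  qed
  \<comment> \<open>The hypothesis enters at \<open>(x, y)\<close> and at \<open>(y, x)\<close>.
    Once \<open>1 + x * q\<close> is factored out, what is left is \<open>bottom\<close> with
    \<open>u = y * q ^ 2\<close> and \<open>v = x * q ^ 2\<close>.\<close>
  show ?case
    unfolding top bottom Suc.IH by (simp add: algebra_simps eval_nat_numeral)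
qed

text \<open>Adding 2 exchanges the residues 1 and 3, so the substitution turns the factor of an odd
  part \<open>i\<close> into that of \<open>i + 2\<close>, while even parts keep theirs; the part 1
  supplies \<open>1 + x * q\<close>.\<close>

lemma mod4_gf_shift:
  "mod4_gf (2 * N + 1) x y q = (1 + x * q) * mod4_gf (2 * N) (y * q ^ 2) (x * q ^ 2) q"
proof (induction N arbitrary: x y)
  case 0
  show ?case
    by (simp add: strict_gf_def strict_partitions_upto_0 strict_partitions_upto_Suc cong_def)
next
  case (Suc N)
  have top: "mod4_gf (2 * Suc N + 1) x y q =
      (1 + (if even N then y else x) * q ^ (2 * N + 3)) * (1 + q ^ (2 * N + 2))
        * mod4_gf (2 * N + 1) x y q"
  proof -
    have "[2 * N + 3 = 1] (mod 4) \<longleftrightarrow> odd N" "[2 * N + 3 = 3] (mod 4) \<longleftrightarrow> even N"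
      "\<not> [2 * N + 2 = 1] (mod 4)" "\<not> [2 * N + 2 = 3] (mod 4)"
      unfolding cong_def by presburger+
    then show ?thesis
      using mod4_gf_Suc[of "2 * N + 2" x y q] mod4_gf_Suc[of "2 * N + 1" x y q]
      by (simp add: eval_nat_numeral mult_ac)
  qed
  have bottom: "mod4_gf (2 * Suc N) u v q =
      (1 + q ^ (2 * N + 2)) * (1 + (if even N then u else v) * q ^ (2 * N + 1))
        * mod4_gf (2 * N) u v q" for u v
  proof -
    have "[2 * N + 1 = 1] (mod 4) \<longleftrightarrow> even N" "[2 * N + 1 = 3] (mod 4) \<longleftrightarrow> odd N"
      "\<not> [2 * N + 2 = 1] (mod 4)" "\<not> [2 * N + 2 = 3] (mod 4)"
      unfolding cong_def by presburger+
    then show ?thesis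
      using mod4_gf_Suc[of "2 * N + 1" u v q] mod4_gf_Suc[of "2 * N" u v q]
      by (simp add: eval_nat_numeral mult_ac)
  qed
  show ?case
    unfolding top bottom Suc.IH by (simp add: eval_nat_numeral mult_ac)
qed

section \<open>Comparing coefficients\<close>

text \<open>Here \<open>int poly poly poly\<close> models three variables: \<open>q\<close> is the
  outermost, \<open>y\<close> the middle and \<open>x\<close> the innermost one, so the coefficient
  in \<open>q\<close> is taken first.\<close>

lemma coeff_sum_monomials:
  fixes a b c :: "'i \<Rightarrow> nat"
  assumes "finite I"
  shows "coeff (coeff (coeff (\<Sum>i\<in>I. [:[:[:0, 1::int:]:]:] ^ a i * [:[:0, 1:]:] ^ b i * [:0, 1:] ^ c i) n) l) k
           = int (card {i \<in> I. a i = k \<and> b i = l \<and> c i = n})"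
proof -
  have "[:[:[:0, 1::int:]:]:] ^ k * [:[:0, 1:]:] ^ l * [:0, 1:] ^ n = monom (monom (monom 1 k) l) n"
    for k l n
    by (simp add: monom_altdef poly_const_pow flip: smult_monom)
  then have "coeff (coeff (coeff (\<Sum>i\<in>I. [:[:[:0, 1::int:]:]:] ^ a i * [:[:0, 1:]:] ^ b i * [:0, 1:] ^ c i) n) l) k
      = (\<Sum>i\<in>I. of_bool (a i = k \<and> b i = l \<and> c i = n))"
    by (auto simp: coeff_sum intro!: sum.cong)
  also have "\<dots> = int (card {i \<in> I. a i = k \<and> b i = l \<and> c i = n})"
    using assms by (simp add: Int_def)
  finally show ?thesis .
qed

text \<open>Expanding \<open>1 + x * q\<close> over \<open>\<epsilon>\<close> leaves a sum of
  monomials, whose coefficients are again counts of lists.\<close>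

lemma strict_gf_shifted_eq:
  "(1 + x * q) * strict_gf f g N (y * q ^ 2) (x * q ^ 2) q =
     (\<Sum>\<epsilon>\<in>{0, 1}. \<Sum>xs\<in>strict_partitions_upto N.
        x ^ (\<epsilon> + g xs) * y ^ f xs * q ^ (\<epsilon> + 2 * (f xs + g xs) + sum_list xs))"
proof -
  have "x ^ (\<epsilon> + j) * y ^ i * q ^ (\<epsilon> + 2 * (i + j) + s) =
      (x * q) ^ \<epsilon> * ((y * q ^ 2) ^ i * (x * q ^ 2) ^ j * q ^ s)" for \<epsilon> i j s
    by (simp add: power_mult_distrib power_add distrib_left mult_ac flip: power_mult)
  then show ?thesis
    by (simp add: strict_gf_def distrib_right sum_distrib_left sum.distrib)
qed

definition joint_count :: "(nat list \<Rightarrow> nat) \<Rightarrow> (nat list \<Rightarrow> nat) \<Rightarrow> nat \<Rightarrow> nat \<Rightarrow> nat \<Rightarrow> nat" where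
  "joint_count f g n k l = card {xs \<in> distinct_partitions_of n. f xs = k \<and> g xs = l}"

text \<open>In the coefficient of \<open>x ^ k * y ^ l * q ^ n\<close>, the exponents force
  \<open>f xs = l\<close>, \<open>g xs = k - \<epsilon>\<close> and the remaining size; the
  \<open>if\<close> guards the truncated subtractions.\<close>

lemma joint_count_rec:
  assumes shift: "\<And>N (x :: int poly poly poly) y q.
      strict_gf f g (2 * N + 1) x y q = (1 + x * q) * strict_gf f g (2 * N) (y * q ^ 2) (x * q ^ 2) q"
  shows "joint_count f g n k l = (\<Sum>\<epsilon>\<in>{0, 1}.
      if \<epsilon> \<le> k \<and> \<epsilon> + 2 * (k - \<epsilon> + l) \<le> n
      then joint_count f g (n - (\<epsilon> + 2 * (k - \<epsilon> + l))) l (k - \<epsilon>) else 0)"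
proof -
  let ?x = "[:[:[:0, 1::int:]:]:]" and ?y = "[:[:0, 1::int poly:]:]" and ?q = "[:0, 1::int poly poly:]"
  \<comment> \<open>Taking \<open>N = n\<close> in \<open>shift\<close> bounds the parts by
    \<open>2 * n + 1\<close> and \<open>2 * n\<close>; both are at least \<open>n\<close>, so no
    relevant partition is lost.\<close>
  let ?S = "strict_partitions_upto (2 * n)"
  let ?m = "\<lambda>\<epsilon>. \<epsilon> + 2 * (k - \<epsilon> + l)"
  have fiber: "card {xs \<in> ?S. \<epsilon> + g xs = k \<and> f xs = l \<and> \<epsilon> + 2 * (f xs + g xs) + sum_list xs = n} =
      (if \<epsilon> \<le> k \<and> ?m \<epsilon> \<le> n then joint_count f g (n - ?m \<epsilon>) l (k - \<epsilon>) else 0)" for \<epsilon>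
  proof (cases "\<epsilon> \<le> k \<and> ?m \<epsilon> \<le> n")
    case True
    have "distinct_partitions_of (n - ?m \<epsilon>) = {xs \<in> ?S. sum_list xs = n - ?m \<epsilon>}"
      by (rule distinct_partitions_of_eq) simp
    moreover have "\<epsilon> + g xs = k \<and> f xs = l \<and> \<epsilon> + 2 * (f xs + g xs) + sum_list xs = n \<longleftrightarrow>
        sum_list xs = n - ?m \<epsilon> \<and> f xs = l \<and> g xs = k - \<epsilon>" for xs
    proof -
      obtain j where j: "k = \<epsilon> + j" using True le_Suc_ex by blast
      obtain d where "n = ?m \<epsilon> + d" using True le_Suc_ex by blast
      then show ?thesis using j by auto
    qed
    then have "{xs \<in> ?S. \<epsilon> + g xs = k \<and> f xs = l \<and> \<epsilon> + 2 * (f xs + g xs) + sum_list xs = n} =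
        {xs \<in> {xs \<in> ?S. sum_list xs = n - ?m \<epsilon>}. f xs = l \<and> g xs = k - \<epsilon>}"
      by blast
    ultimately show ?thesis
      using True by (simp only: joint_count_def if_True simp_thms)
  next
    case False
    then have "{xs \<in> ?S. \<epsilon> + g xs = k \<and> f xs = l \<and> \<epsilon> + 2 * (f xs + g xs) + sum_list xs = n} = {}"
      by auto
    then show ?thesis using False by auto
  qed
  have "distinct_partitions_of n = {xs \<in> strict_partitions_upto (2 * n + 1). sum_list xs = n}"
    by (rule distinct_partitions_of_eq) simp
  then have "int (joint_count f g n k l) =
      coeff (coeff (coeff (strict_gf f g (2 * n + 1) ?x ?y ?q) n) l) k"
    unfolding strict_gf_def joint_count_def
    by (subst coeff_sum_monomials) (auto intro!: arg_cong[where f = card])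
  also have "strict_gf f g (2 * n + 1) ?x ?y ?q =
      (1 + ?x * ?q) * strict_gf f g (2 * n) (?y * ?q ^ 2) (?x * ?q ^ 2) ?q"
    by (rule shift)
  also have "\<dots> = (\<Sum>\<epsilon>\<in>{0, 1}. \<Sum>xs\<in>?S.
      ?x ^ (\<epsilon> + g xs) * ?y ^ f xs * ?q ^ (\<epsilon> + 2 * (f xs + g xs) + sum_list xs))"
    by (rule strict_gf_shifted_eq)
  also have "coeff (coeff (coeff \<dots> n) l) k = (\<Sum>\<epsilon>\<in>{0, 1}.
      int (card {xs \<in> ?S. \<epsilon> + g xs = k \<and> f xs = l \<and> \<epsilon> + 2 * (f xs + g xs) + sum_list xs = n}))"
    by (simp only: coeff_sum coeff_sum_monomials[OF finite_strict_partitions_upto, symmetric])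
  finally show ?thesis
    unfolding fiber by (simp only: of_nat_sum[symmetric] of_nat_eq_iff)
qed

text \<open>The recursion lowers \<open>n\<close> unless \<open>k = l = 0\<close>. In that case the
  condition says that the sum of the two statistics is 0, and \<open>sum_eq\<close> applies.\<close>

lemma joint_count_eqI:
  assumes "\<And>N (x :: int poly poly poly) y q.
      strict_gf f g (2 * N + 1) x y q = (1 + x * q) * strict_gf f g (2 * N) (y * q ^ 2) (x * q ^ 2) q"
    and "\<And>N (x :: int poly poly poly) y q.
      strict_gf f' g' (2 * N + 1) x y q = (1 + x * q) * strict_gf f' g' (2 * N) (y * q ^ 2) (x * q ^ 2) q"
    and sum_eq: "\<And>xs. f xs + g xs = f' xs + g' xs"
  shows "joint_count f g n k l = joint_count f' g' n k l"
proof (induction n arbitrary: k l rule: less_induct)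
  case (less n)
  show ?case
  proof (cases "k = 0 \<and> l = 0")
    case True
    have "f xs = 0 \<and> g xs = 0 \<longleftrightarrow> f' xs = 0 \<and> g' xs = 0" for xs
      using sum_eq[of xs] by auto
    then show ?thesis using True by (simp add: joint_count_def)
  next
    case False
    have "joint_count f g (n - (\<epsilon> + 2 * (k - \<epsilon> + l))) l (k - \<epsilon>) =
          joint_count f' g' (n - (\<epsilon> + 2 * (k - \<epsilon> + l))) l (k - \<epsilon>)"
      if "\<epsilon> \<le> k" "\<epsilon> + 2 * (k - \<epsilon> + l) \<le> n" for \<epsilon>
      \<comment> \<open>As \<open>k\<close> and \<open>l\<close> are not both 0 and
        \<open>\<epsilon> \<le> k\<close>, the amount subtracted from \<open>n\<close> is
        positive.\<close>
      using that False by (intro less.IH) auto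
    then show ?thesis
      unfolding joint_count_rec[OF assms(1), of n k l] joint_count_rec[OF assms(2), of n k l]
      by (intro sum.cong if_cong refl) blast
  qed
qed

lemma joint_count_index_eq_mod4:
  "joint_count num_odd_indexed_odd_parts num_even_indexed_odd_parts n k l =
   joint_count (num_parts_cong 1 4) (num_parts_cong 3 4) n k l"
  by (rule joint_count_eqI[OF index_gf_shift mod4_gf_shift])
     (simp only: num_indexed_odd_parts_sum num_parts_cong_sum)

theorem theorem2p4:
  fixes k n :: nat
  shows "card {xs \<in> distinct_partitions_of n. num_odd_indexed_odd_parts xs = k}
           = card {xs \<in> distinct_partitions_of n. num_parts_cong 1 4 xs = k}
       \<and> card {xs \<in> distinct_partitions_of n. num_even_indexed_odd_parts xs = k}
           = card {xs \<in> distinct_partitions_of n. num_parts_cong 3 4 xs = k}"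
proof -
  let ?f = "\<lambda>xs. (num_odd_indexed_odd_parts xs, num_even_indexed_odd_parts xs)"
  let ?f' = "\<lambda>xs. (num_parts_cong 1 4 xs, num_parts_cong 3 4 xs)"
  let ?D = "mset_set (distinct_partitions_of n)"
  \<comment> \<open>Equal joint counts mean equal multisets of value pairs; projecting these to a
    component gives each marginal without summing over the other index.\<close>
  have count: "count (image_mset h ?D) c = card {xs \<in> distinct_partitions_of n. h xs = c}"
    for h :: "nat list \<Rightarrow> 'c" and c
  proof -
    have "count (image_mset h ?D) c = (\<Sum>xs | xs \<in> distinct_partitions_of n \<and> c = h xs. 1)"
      unfolding count_image_mset'
      by (intro sum.cong) (auto simp: finite_distinct_partitions_of)
    then show ?thesis by (simp add: eq_commute)
  qed
  have eq: "image_mset ?f ?D = image_mset ?f' ?D"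
    using joint_count_index_eq_mod4[of n]
    by (intro multiset_eqI) (auto simp: count joint_count_def)
  show ?thesis
    using arg_cong[OF eq, of "image_mset fst"] arg_cong[OF eq, of "image_mset snd"]
    by (simp add: multiset.map_comp o_def flip: count)
qed

end
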